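(* Let $(P,\preceq)$ be a finite partially ordered set that can be consistently evaluated (i.e. has a consistent evaluator). Then all consistent evaluators of $(P,\preceq)$ are equivalent: for any pair of consistent evaluators $f_a,f_b$ of $(P,\preceq)$ (possibly with values in different totally ordered sets) and all $P_1,P_2\subseteq P$, $$f_a(P_1)\le f_a(P_2)\iff f_b(P_1)\le f_b(P_2).$$
   Context: Write $x\prec y$ for $x\preceq y$ and $x\neq y$. An antichain is a subset in which any two distinct elements are incomparable. Consistent evaluator: a consistent evaluator for a poset $(P,\preceq)$ is a function $f:2^{P}\to T$, where $T$ is a totally ordered set with order $\le$, such that for all subsets $P_1,P_2\subseteq P$: (1) $P_1\neq\varnothing \Rightarrow f(\varnothing)<f(P_1)$; (2) if $p_1\in P_1$, $p_2\in P_2$ and $f(\{p_1\})=f(\{p_2\})$, then $f(P_1)\le f(P_2)$ implies $f(P_1\setminus\{p_1\})\le f(P_2\setminus\{p_2\})$; (3) (for $P_1,P_2$ nonempty, so that the maxima exist) if $f(\{p_1\})\neq f(\{p_2\})$ for all $p_1\in P_1$, $p_2\in P_2$, then $\max_{p\in P_1}f(\{p\})<\max_{q\in P_2}f(\{q\})$ implies $f(P_1)<f(P_2)$; and for all $p_1,p_2\in P$: (4) $p_1\prec p_2\Rightarrow f(\{p_1\})<f(\{p_2\})$; (5) if $\{p_1,p_2\}$ is an antichain and $f(\{p_1\})<f(\{p_2\})$, then there exist $s,t\in P$ with $p_1\prec s$, $f(\{s\})=f(\{p_2\})$, $f(\{t\})=f(\{p_1\})$ and $t\prec p_2$. *)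

theory Defs
  imports Main
begin

definition strictly_below :: "'a rel \<Rightarrow> 'a \<Rightarrow> 'a \<Rightarrow> bool" where
  "strictly_below r x y \<longleftrightarrow> (x, y) \<in> r \<and> x \<noteq> y"

definition antichain_on :: "'a set \<Rightarrow> 'a rel \<Rightarrow> 'a set \<Rightarrow> bool" where
  "antichain_on P r A \<longleftrightarrow>
     A \<subseteq> P \<and> (\<forall>x\<in>A. \<forall>y\<in>A. x \<noteq> y \<longrightarrow> (x, y) \<notin> r \<and> (y, x) \<notin> r)"

(* The poset is a carrier P with a relation r. The totally ordered set T is an arbitrary type of
   class linorder. An evaluator is constrained only on subsets of P; its values elsewhere are
   irrelevant. The third clause is meaningful for finite P only, since Max is unspecified on
   infinite sets. *)
definition consistent_evaluator :: "'a set \<Rightarrow> 'a rel \<Rightarrow> ('a set \<Rightarrow> 't::linorder) \<Rightarrow> bool" where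
  "consistent_evaluator P r f \<longleftrightarrow>
     (\<forall>P\<^sub>1\<subseteq>P. P\<^sub>1 \<noteq> {} \<longrightarrow> f {} < f P\<^sub>1) \<and>
     (\<forall>P\<^sub>1\<subseteq>P. \<forall>P\<^sub>2\<subseteq>P. \<forall>p\<^sub>1\<in>P\<^sub>1. \<forall>p\<^sub>2\<in>P\<^sub>2. f {p\<^sub>1} = f {p\<^sub>2} \<longrightarrow>
        f P\<^sub>1 \<le> f P\<^sub>2 \<longrightarrow> f (P\<^sub>1 - {p\<^sub>1}) \<le> f (P\<^sub>2 - {p\<^sub>2})) \<and>
     (\<forall>P\<^sub>1\<subseteq>P. \<forall>P\<^sub>2\<subseteq>P. P\<^sub>1 \<noteq> {} \<longrightarrow> P\<^sub>2 \<noteq> {} \<longrightarrow>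
        (\<forall>p\<^sub>1\<in>P\<^sub>1. \<forall>p\<^sub>2\<in>P\<^sub>2. f {p\<^sub>1} \<noteq> f {p\<^sub>2}) \<longrightarrow>
        Max ((\<lambda>p. f {p}) ` P\<^sub>1) < Max ((\<lambda>q. f {q}) ` P\<^sub>2) \<longrightarrow> f P\<^sub>1 < f P\<^sub>2) \<and>
     (\<forall>p\<^sub>1\<in>P. \<forall>p\<^sub>2\<in>P. strictly_below r p\<^sub>1 p\<^sub>2 \<longrightarrow> f {p\<^sub>1} < f {p\<^sub>2}) \<and>
     (\<forall>p\<^sub>1\<in>P. \<forall>p\<^sub>2\<in>P. antichain_on P r {p\<^sub>1, p\<^sub>2} \<longrightarrow> f {p\<^sub>1} < f {p\<^sub>2} \<longrightarrow>
        (\<exists>s\<in>P. \<exists>t\<in>P. strictly_below r p\<^sub>1 s \<and> f {s} = f {p\<^sub>2} \<and>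
                      f {t} = f {p\<^sub>1} \<and> strictly_below r t p\<^sub>2))"

end

(* If f{q} < f{p}, then conditions (4) and (5) give some t below p with f{t} = f{q}. So the values
   below f{p} are exactly the values of the elements strictly below p, and by induction their number
   depends on the order alone: call it the level of p. Singletons are ordered by their levels.
   Exchanging equal elements one at a time, by (2) with P1 = P2, shows that f(X) depends only on the
   multiset of levels in X. By (2) a strict inequality survives adding an element of the same
   level to both sides, so cancelling common levels reduces the comparison of f(X) and f(Y) to (1) or
   (3). Thus f orders the subsets by the multiset order on their levels. *)
theory Submission
  imports Defs "HOL-Library.Multiset_Order"
begin

locale evaluated_poset =
  fixes P :: "'a set" and r :: "'a rel" and f :: "'a set \<Rightarrow> 't::linorder"
  assumes finite_P: "finite P"
    and consistent: "consistent_evaluator P r f"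
begin

lemmas conditions = consistent[unfolded consistent_evaluator_def]

lemma empty_less: "X \<subseteq> P \<Longrightarrow> X \<noteq> {} \<Longrightarrow> f {} < f X"
  using conditions[THEN conjunct1] by simp

lemma remove_le:
  "\<lbrakk>X \<subseteq> P; Y \<subseteq> P; x \<in> X; y \<in> Y; f {x} = f {y}; f X \<le> f Y\<rbrakk> \<Longrightarrow> f (X - {x}) \<le> f (Y - {y})"
  by (rule conditions[THEN conjunct2, THEN conjunct1, rule_format])

lemma less_if_Max_less:
  "\<lbrakk>X \<subseteq> P; Y \<subseteq> P; X \<noteq> {}; Y \<noteq> {}; \<forall>x\<in>X. \<forall>y\<in>Y. f {x} \<noteq> f {y};
    Max ((\<lambda>p. f {p}) ` X) < Max ((\<lambda>q. f {q}) ` Y)\<rbrakk> \<Longrightarrow> f X < f Y"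
  by (rule conditions[THEN conjunct2, THEN conjunct2, THEN conjunct1, rule_format]) auto

lemma strictly_below_less:
  "\<lbrakk>p \<in> P; q \<in> P; strictly_below r p q\<rbrakk> \<Longrightarrow> f {p} < f {q}"
  by (rule conditions[THEN conjunct2, THEN conjunct2, THEN conjunct2, THEN conjunct1, rule_format])

lemma antichain_witness_below:
  "\<lbrakk>p \<in> P; q \<in> P; antichain_on P r {p, q}; f {p} < f {q}\<rbrakk>
    \<Longrightarrow> \<exists>t\<in>P. f {t} = f {p} \<and> strictly_below r t q"
  using conditions[THEN conjunct2, THEN conjunct2, THEN conjunct2, THEN conjunct2, rule_format, of p q] by blast

text \<open>Condition (5) gives this for incomparable elements. If \<open>p\<close> is strictly
  below \<open>q\<close>, then \<open>p\<close> itself is the witness, and by (4) the reverse order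
  cannot occur.\<close>

lemma witness_below:
  assumes "p \<in> P" "q \<in> P" "f {p} < f {q}"
  shows "\<exists>t\<in>P. f {t} = f {p} \<and> strictly_below r t q"
proof (cases "strictly_below r p q")
  case True
  with assms show ?thesis by blast
next
  case False
  have "\<not> strictly_below r q p"
    using strictly_below_less[of q p] assms by force
  with False have "antichain_on P r {p, q}"
    using assms by (auto simp: antichain_on_def strictly_below_def)
  with assms show ?thesis by (intro antichain_witness_below)
qed

text \<open>Distinct values are counted, not elements: several elements of equal value below
  \<open>p\<close> contribute only once.\<close>

definition level :: "'a \<Rightarrow> nat" where
  "level p = card ((\<lambda>t. f {t}) ` {t \<in> P. strictly_below r t p})"

text \<open>One inclusion is (4), the other is \<open>witness_below\<close>. It turns
  \<open>level p\<close>, a count along the order, into the rank of \<open>f {p}\<close> among all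
  singleton values.\<close>

lemma values_strictly_below:
  assumes "p \<in> P"
  shows "(\<lambda>t. f {t}) ` {t \<in> P. strictly_below r t p} = {v \<in> (\<lambda>q. f {q}) ` P. v < f {p}}"
proof (intro equalityI subsetI)
  fix v
  assume "v \<in> (\<lambda>t. f {t}) ` {t \<in> P. strictly_below r t p}"
  then show "v \<in> {v \<in> (\<lambda>q. f {q}) ` P. v < f {p}}"
    using strictly_below_less[OF _ assms] by auto
next
  fix v
  assume "v \<in> {v \<in> (\<lambda>q. f {q}) ` P. v < f {p}}"
  then obtain q where q: "q \<in> P" "v = f {q}" "f {q} < f {p}" by blast
  with assms obtain t where "t \<in> P" "f {t} = f {q}" "strictly_below r t p"
    using witness_below by blast
  with q show "v \<in> (\<lambda>t. f {t}) ` {t \<in> P. strictly_below r t p}" by (auto simp: image_iff)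
qed

lemma level_less:
  assumes "p \<in> P" "q \<in> P" "f {p} < f {q}"
  shows "level p < level q"
proof -
  have "{v \<in> (\<lambda>q. f {q}) ` P. v < f {p}} \<subset> {v \<in> (\<lambda>q. f {q}) ` P. v < f {q}}"
    using assms by (intro psubsetI) auto
  then show ?thesis
    unfolding level_def using assms finite_P
    by (simp add: values_strictly_below psubset_card_mono)
qed

lemma level_eq_iff:
  assumes "p \<in> P" "q \<in> P"
  shows "level p = level q \<longleftrightarrow> f {p} = f {q}"
proof
  assume "level p = level q"
  then show "f {p} = f {q}"
    using level_less[of p q] level_less[of q p] assms
    by (cases "f {p}" "f {q}" rule: linorder_cases) auto
next
  assume "f {p} = f {q}"
  then show "level p = level q"
    unfolding level_def using assms by (simp add: values_strictly_below)
qed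

lemma level_less_iff:
  assumes "p \<in> P" "q \<in> P"
  shows "level p < level q \<longleftrightarrow> f {p} < f {q}"
  using level_less[of p q] level_less[of q p] level_eq_iff[of p q] assms
  by (cases "f {p}" "f {q}" rule: linorder_cases) auto

text \<open>Distinct values have distinct levels, so counting the levels below \<open>p\<close>
  gives the same number as counting the values. In this recursion \<open>f\<close> enters only
  through \<open>level\<close> itself, so the order determines \<open>level\<close>.\<close>

lemma level_rec:
  assumes "p \<in> P"
  shows "level p = card (level ` {t \<in> P. strictly_below r t p})"
proof -
  let ?B = "{t \<in> P. strictly_below r t p}"
  define g where "g v = card {w \<in> (\<lambda>q. f {q}) ` P. w < v}" for v
  have g: "\<forall>t\<in>?B. level t = g (f {t})"
    by (simp add: level_def g_def values_strictly_below)
  have "inj_on g ((\<lambda>t. f {t}) ` ?B)"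
  proof (rule inj_onI)
    fix u v
    assume "u \<in> (\<lambda>t. f {t}) ` ?B" "v \<in> (\<lambda>t. f {t}) ` ?B" "g u = g v"
    then obtain s t where st: "s \<in> ?B" "u = f {s}" "t \<in> ?B" "v = f {t}" by blast
    with g \<open>g u = g v\<close> have "level s = level t" by simp
    with st show "u = v" by (simp add: level_eq_iff)
  qed
  then have "card (g ` (\<lambda>t. f {t}) ` ?B) = level p"
    by (simp add: card_image level_def)
  moreover have "g ` (\<lambda>t. f {t}) ` ?B = level ` ?B"
    using g by (auto simp: image_image)
  ultimately show ?thesis by simp
qed

definition levels :: "'a set \<Rightarrow> nat multiset" where
  "levels X = image_mset level (mset_set X)"

lemma finite_sub: "X \<subseteq> P \<Longrightarrow> finite X"
  using finite_P finite_subset by blast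

lemma levels_remove:
  assumes "X \<subseteq> P" "x \<in> X"
  shows "levels X = add_mset (level x) (levels (X - {x}))"
  using assms finite_sub by (simp add: levels_def mset_set.remove[of X x])

lemma mem_levels: "X \<subseteq> P \<Longrightarrow> n \<in># levels X \<longleftrightarrow> (\<exists>x\<in>X. level x = n)"
  using finite_sub by (auto simp: levels_def)

text \<open>Condition (2) is applied to \<open>Z\<close> and \<open>Z\<close>, once in each
  direction, starting from the trivial \<open>f Z \<le> f Z\<close>.\<close>

lemma exchange_eq:
  assumes "Z \<subseteq> P" "x \<in> Z" "y \<in> Z" "level x = level y"
  shows "f (Z - {x}) = f (Z - {y})"
proof -
  have "f {x} = f {y}" using assms level_eq_iff by blast
  with assms show ?thesis by (intro antisym remove_le) auto
qed

text \<open>\<open>X\<close> is moved towards \<open>Y\<close> by replacing an element outside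
  \<open>Y\<close> with one of \<open>Y\<close> at the same level. Each exchange keeps
  \<open>f X\<close> and \<open>levels X\<close> and shrinks \<open>X - Y\<close>.\<close>

lemma eq_if_levels_eq:
  assumes "X \<subseteq> P" "Y \<subseteq> P" "levels X = levels Y"
  shows "f X = f Y"
  using assms(1,3)
proof (induction "card (X - Y)" arbitrary: X rule: less_induct)
  case less
  have fin: "finite X" "finite Y" using less.prems assms finite_sub by auto
  show ?case
  proof (cases "X \<subseteq> Y")
    case True
    have "card X = card Y"
      using arg_cong[OF less.prems(2), of size] by (simp add: levels_def)
    with True fin have "X = Y" by (intro card_subset_eq)
    then show ?thesis by simp
  next
    case False
    then obtain x where x: "x \<in> X" "x \<notin> Y" by blast
    have split: "levels A = levels (A - B) + levels (A \<inter> B)" if "A \<subseteq> P" for A B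
    proof -
      have "mset_set A = mset_set (A - B) + mset_set (A \<inter> B)"
        using finite_sub[OF that] by (subst mset_set_Union[symmetric]) (auto simp: Un_Diff_Int)
      then show ?thesis by (simp add: levels_def)
    qed
    \<comment> \<open>The common elements contribute equally to both sides and cancel, so a partner
      for \<open>x\<close> can be found outside \<open>X\<close>.\<close>
    have "levels (X - Y) = levels (Y - X)"
      using split[OF less.prems(1), of Y] split[OF assms(2), of X] less.prems(2)
      by (simp add: Int_commute)
    moreover have "X - Y \<subseteq> P" "Y - X \<subseteq> P" using less.prems assms(2) by auto
    ultimately have "(\<exists>y\<in>X - Y. level y = level x) \<longleftrightarrow> (\<exists>y\<in>Y - X. level y = level x)"
      by (simp flip: mem_levels)
    then obtain y where y: "y \<in> Y" "y \<notin> X" "level y = level x"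
      using x by blast
    \<comment> \<open>Both \<open>X\<close> and \<open>X'\<close> arise from
      \<open>insert y X\<close> by deleting one of two elements of equal level, which is the
      situation of \<open>exchange_eq\<close>.\<close>
    define X' where "X' = insert y X - {x}"
    have Z: "insert y X \<subseteq> P" using y less.prems assms(2) by blast
    have X: "insert y X - {y} = X" using y by blast
    have eq: "f X' = f X"
      using exchange_eq[OF Z, of x y] x y X by (simp add: X'_def)
    have lev: "levels X' = levels X"
      using levels_remove[OF Z, of x] levels_remove[OF Z, of y] x y X by (simp add: X'_def)
    have "X' - Y \<subset> X - Y" using x y by (auto simp: X'_def)
    then have "card (X' - Y) < card (X - Y)" using fin by (simp add: psubset_card_mono)
    moreover have "X' \<subseteq> P" using Z by (auto simp: X'_def)
    ultimately have "f X' = f Y" using less.hyps lev less.prems by simp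
    with eq show ?thesis by simp
  qed
qed

text \<open>The base case after cancellation: condition (1) if \<open>X\<close> is empty, condition
  (3) otherwise.\<close>

lemma less_if_dominated:
  assumes "X \<subseteq> P" "Y \<subseteq> P" "m \<in> Y"
    and less: "\<And>x. x \<in> X \<Longrightarrow> level x < level m"
    and disjoint: "\<And>x y. \<lbrakk>x \<in> X; y \<in> Y\<rbrakk> \<Longrightarrow> level x \<noteq> level y"
  shows "f X < f Y"
proof (cases "X = {}")
  case True
  with assms show ?thesis using empty_less by blast
next
  case False
  have fin: "finite X" "finite Y" using assms finite_sub by auto
  have "f {x} < f {m}" if "x \<in> X" for x
    using less[OF that] level_less_iff[of x m] assms(1-3) that by blast
  then have "Max ((\<lambda>p. f {p}) ` X) < f {m}"
    using fin False by (subst Max_less_iff) auto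
  also have "f {m} \<le> Max ((\<lambda>p. f {p}) ` Y)"
    using fin assms by simp
  finally have "Max ((\<lambda>p. f {p}) ` X) < Max ((\<lambda>p. f {p}) ` Y)" .
  moreover have "\<forall>x\<in>X. \<forall>y\<in>Y. f {x} \<noteq> f {y}"
    using disjoint level_eq_iff assms(1,2) by (metis subsetD)
  moreover have "Y \<noteq> {}" using assms(3) by blast
  ultimately show ?thesis using assms(1,2) False by (intro less_if_Max_less)
qed

text \<open>Pairs of equal level are removed from \<open>X\<close> and \<open>Y\<close> until none
  is left; then the top level of \<open>Y\<close> exceeds every level in \<open>X\<close>.\<close>

lemma less_if_levels_less:
  assumes "X \<subseteq> P" "Y \<subseteq> P" "levels X < levels Y"
  shows "f X < f Y"
  using assms
proof (induction "card X" arbitrary: X Y rule: less_induct)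
  case less
  have fin: "finite X" "finite Y" using less.prems finite_sub by auto
  show ?case
  proof (cases "\<exists>x\<in>X. \<exists>y\<in>Y. level x = level y")
    case True
    then obtain x y where xy: "x \<in> X" "y \<in> Y" "level x = level y" by blast
    have "levels (X - {x}) < levels (Y - {y})"
      using less.prems xy levels_remove[of X x] levels_remove[of Y y] by simp
    moreover have "card (X - {x}) < card X" using xy fin by (intro card_Diff1_less)
    moreover have "X - {x} \<subseteq> P" "Y - {y} \<subseteq> P" using less.prems by auto
    ultimately have "f (X - {x}) < f (Y - {y})" by (intro less.hyps)
    moreover have "f {x} = f {y}" using xy less.prems level_eq_iff by blast
    \<comment> \<open>This is the contrapositive of (2): \<open>f Y \<le> f X\<close> would survive
      the removal of \<open>y\<close> and \<open>x\<close>.\<close>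
    ultimately show ?thesis
      using remove_le[of Y X y x] xy less.prems(1,2) by (metis not_le)
  next
    case False
    have "Y \<noteq> {}" using less.prems by (auto simp: levels_def)
    then have "Max (level ` Y) \<in> level ` Y" using fin by simp
    then obtain m where m: "m \<in> Y" "level m = Max (level ` Y)" by force
    have "level x < level m" if x: "x \<in> X" for x
    proof -
      have "level x \<notin># levels Y" "level x \<in># levels X"
        using False x less.prems(1,2) by (force simp: mem_levels)+
      then have "count (levels Y) (level x) < count (levels X) (level x)"
        by (simp add: not_in_iff)
      \<comment> \<open>The Huet-Oppen form of the multiset order: a level that is more frequent in
        the smaller multiset is compensated by a higher one that is more frequent in the
        larger.\<close>
      then obtain n where n: "level x < n" "count (levels X) n < count (levels Y) n"
        using less.prems(3) unfolding less_multiset\<^sub>H\<^sub>O by blast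
      then have "n \<in># levels Y" by (metis count_greater_zero_iff not_less_zero gr0I)
      then obtain y where "y \<in> Y" "level y = n" using less.prems by (auto simp: mem_levels)
      with n m fin show ?thesis by (metis Max_ge finite_imageI imageI less_le_trans)
    qed
    with less.prems m False show ?thesis by (intro less_if_dominated[of X Y m]) auto
  qed
qed

text \<open>The multiset order over \<open>nat\<close> is total, so the equality case and the two
  strict cases settle both directions.\<close>

lemma le_iff_levels_le:
  assumes "X \<subseteq> P" "Y \<subseteq> P"
  shows "f X \<le> f Y \<longleftrightarrow> levels X \<le> levels Y"
  using assms eq_if_levels_eq[of X Y] less_if_levels_less[of X Y] less_if_levels_less[of Y X]
  by (cases "levels X" "levels Y" rule: linorder_cases) auto

end

text \<open>Induction along the level for \<open>f\<close>: by (4) the elements strictly below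
  \<open>p\<close> have smaller level, and \<open>level_rec\<close> has the same form for both
  evaluators.\<close>

lemma level_unique:
  assumes "evaluated_poset P r f" "evaluated_poset P r g" "p \<in> P"
  shows "evaluated_poset.level P r f p = evaluated_poset.level P r g p"
  using assms(3)
proof (induction p rule: measure_induct_rule[of "evaluated_poset.level P r f"])
  case (less p)
  interpret f: evaluated_poset P r f by fact
  interpret g: evaluated_poset P r g by fact
  have "f.level ` {t \<in> P. strictly_below r t p} = g.level ` {t \<in> P. strictly_below r t p}"
  proof (rule image_cong[OF refl])
    fix t
    assume t: "t \<in> {t \<in> P. strictly_below r t p}"
    then have "f.level t < f.level p"
      using less.prems by (intro f.level_less f.strictly_below_less) auto
    with t show "f.level t = g.level t" by (intro less.IH) auto
  qed
  then show ?case by (simp only: f.level_rec[OF less.prems] g.level_rec[OF less.prems])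
qed

theorem theorem4:
  fixes P :: "'a set"
    and r :: "'a rel"
    and f\<^sub>a :: "'a set \<Rightarrow> 's::linorder"
    and f\<^sub>b :: "'a set \<Rightarrow> 't::linorder"
  assumes "finite P"
    and "partial_order_on P r"
    and "consistent_evaluator P r f\<^sub>a"
    and "consistent_evaluator P r f\<^sub>b"
  shows "\<forall>P\<^sub>1\<subseteq>P. \<forall>P\<^sub>2\<subseteq>P. f\<^sub>a P\<^sub>1 \<le> f\<^sub>a P\<^sub>2 \<longleftrightarrow> f\<^sub>b P\<^sub>1 \<le> f\<^sub>b P\<^sub>2"
proof -
  interpret a: evaluated_poset P r f\<^sub>a using assms by unfold_locales
  interpret b: evaluated_poset P r f\<^sub>b using assms by unfold_locales
  have "a.levels X = b.levels X" if "X \<subseteq> P" for X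
    unfolding a.levels_def b.levels_def
    using that a.finite_sub
    by (intro image_mset_cong level_unique[OF a.evaluated_poset_axioms b.evaluated_poset_axioms]) auto
  then show ?thesis by (simp add: a.le_iff_levels_le b.le_iff_levels_le)
qed

end
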